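(* Let $m,n\ge 1$ be integers and let $A\in M_{m,n}(\mathbb{R})$. If $A$ is not singular on average, then $\dim_H \mathbf{Bad}_A(\epsilon)<m$ for any $\epsilon>0$.
   Context: $M_{m,n}(\mathbb{R})$ is the set of $m\times n$ real matrices; $\|\cdot\|$ is the Euclidean norm; $\dim_H$ is Hausdorff dimension. For $v\in\mathbb{R}^m$, $\langle v\rangle:=\inf_{p\in\mathbb{Z}^m}\|v-p\|$. For $\epsilon>0$, a matrix $A\in M_{m,n}(\mathbb{R})$ is called $\epsilon$-bad for $b\in\mathbb{R}^m$ if $$\liminf_{q\in\mathbb{Z}^n,\ \|q\|\to\infty}\|q\|^{n/m}\langle Aq-b\rangle\ge\epsilon .$$ $\mathbf{Bad}_A(\epsilon):=\{b\in\mathbb{R}^m: A \text{ is } \epsilon\text{-bad for } b\}$. A matrix $A\in M_{m,n}(\mathbb{R})$ is called singular on average if for any $\epsilon>0$, $$\lim_{N\to\infty}\frac1N\Bigl|\Bigl\{l\in\{1,\dots,N\}:\exists q\in\mathbb{Z}^n \text{ such that } \langle Aq\rangle<\epsilon\,2^{-nl/m} \text{ and } 0<\|q\|<2^l\Bigr\}\Bigr|=1 .$$ Equivalently (Dani's correspondence), with $d=m+n$, the point $x_A=\begin{pmatrix} I_m & A\\ 0& I_n\end{pmatrix}SL_d(\mathbb{Z})$ of $X=SL_d(\mathbb{R})/SL_d(\mathbb{Z})$ has $1$-escape of mass on average under the flow $a_t=\mathrm{diag}(e^{nt}I_m,e^{-mt}I_n)$: for every compact $Q\subset X$, $\liminf_{N\to\infty}\frac1N|\{l\in\{1,\dots,N\}:a_l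 x_A\notin Q\}|\ge 1$. *)

theory Defs
  imports "HOL-Analysis.Analysis"
begin

section \<open>Hausdorff measure and dimension\<close>

text \<open>
  Contribution of one covering set to the \<open>s\<close>-dimensional Hausdorff sum. For \<open>s > 0\<close> it is
  \<open>(diam U)\<^sup>s\<close>; for \<open>s = 0\<close> every nonempty set counts \<open>1\<close> and the empty set \<open>0\<close>, so that the
  0-dimensional measure is counting measure. The case \<open>s = 0\<close> is separate because
  \<open>0 powr 0 = 0\<close> in HOL.
\<close>

definition hausdorff_weight :: "real \<Rightarrow> 'a::metric_space set \<Rightarrow> ennreal" where
  "hausdorff_weight s U =
     (if U = {} then 0 else if s = 0 then 1 else ennreal (diameter U powr s))"

text \<open>
  Boundedness is required explicitly since \<^const>\<open>diameter\<close> is a real number and carries no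
  information about unbounded sets. Finite covers are included, as the sets may be empty.
\<close>

definition delta_covers :: "real \<Rightarrow> 'a::metric_space set \<Rightarrow> (nat \<Rightarrow> 'a set) set" where
  "delta_covers \<delta> S =
     {U. S \<subseteq> (\<Union>i. U i) \<and> (\<forall>i. bounded (U i) \<and> diameter (U i) \<le> \<delta>)}"

definition hausdorff_premeasure :: "real \<Rightarrow> real \<Rightarrow> 'a::metric_space set \<Rightarrow> ennreal" where
  "hausdorff_premeasure s \<delta> S = (INF U\<in>delta_covers \<delta> S. \<Sum>i. hausdorff_weight s (U i))"

definition hausdorff_measure :: "real \<Rightarrow> 'a::metric_space set \<Rightarrow> ennreal" where
  "hausdorff_measure s S = (SUP \<delta>\<in>{0<..}. hausdorff_premeasure s \<delta> S)"

text \<open>The empty set gets dimension \<open>0\<close>.\<close>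

definition hausdorff_dim :: "'a::metric_space set \<Rightarrow> ennreal" where
  "hausdorff_dim S = (INF s\<in>{s. 0 \<le> s \<and> hausdorff_measure s S = 0}. ennreal s)"


section \<open>Inhomogeneous Diophantine approximation\<close>

text \<open>
  A matrix with \<open>m\<close> rows and \<open>n\<close> columns is an element of \<^typ>\<open>real ^ 'n ^ 'm\<close>, with
  \<open>m = CARD('m)\<close> and \<open>n = CARD('n)\<close>; these are automatically positive.
\<close>

definition integer_vectors :: "(real ^ 'k) set" where
  "integer_vectors = {p. \<forall>i. p $ i \<in> \<int>}"

definition dist_to_integers :: "real ^ 'k \<Rightarrow> real" where
  "dist_to_integers v = (INF p\<in>integer_vectors. norm (v - p))"

text \<open>
  The lower limit runs over integer vectors whose norm tends to infinity. It is taken in the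
  extended reals, so the value \<open>\<infinity>\<close> is allowed.
\<close>

definition eps_bad :: "real \<Rightarrow> real ^ 'n ^ 'm \<Rightarrow> real ^ 'm \<Rightarrow> bool" where
  "eps_bad \<epsilon> A b \<longleftrightarrow>
     Liminf (inf at_infinity (principal integer_vectors))
       (\<lambda>q. ereal (norm q powr (real CARD('n) / real CARD('m)) * dist_to_integers (A *v q - b)))
     \<ge> ereal \<epsilon>"

definition Bad :: "real ^ 'n ^ 'm \<Rightarrow> real \<Rightarrow> (real ^ 'm) set" where
  "Bad A \<epsilon> = {b. eps_bad \<epsilon> A b}"

definition singular_on_average :: "real ^ 'n ^ 'm \<Rightarrow> bool" where
  "singular_on_average A \<longleftrightarrow>
     (\<forall>\<epsilon>>0. (\<lambda>N::nat.
        real (card {l \<in> {1..N}. \<exists>q\<in>integer_vectors.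
            dist_to_integers (A *v q) < \<epsilon> * 2 powr (- (real CARD('n) * real l / real CARD('m)))
            \<and> 0 < norm q \<and> norm q < 2 ^ l}) / real N)
        \<longlonglongrightarrow> 1)"

end

theory Submission
  imports Defs
begin

text \<open>
  Let \<open>\<beta>\<close> be \<open>2\<close> to the power \<open>- n / m\<close>. Call a scale \<open>l\<close> good if no nonzero integral \<open>q\<close> of norm
  below \<open>2\<^sup>l\<close> has \<open>A q\<close> at distance less than \<open>\<epsilon>' \<beta>\<^sup>l\<close> from the integral vectors. If \<open>A\<close> is not
  singular on average, then for some \<open>\<epsilon>' > 0\<close> the good scales have positive upper density
  (\<open>good_scales_dense\<close>).

  At a good scale the lattice of all \<open>(A q + p, q)\<close>, suitably rescaled, has no short vectors, hence its
  covering radius is bounded by a constant: every \<open>b\<close> is approximated by some \<open>A q + p\<close> with error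
  \<open>O(\<beta>\<^sup>l)\<close> and \<open>q\<close> of norm \<open>O(2\<^sup>l)\<close> (\<open>inhomogeneous_solution\<close>).
  This is proved by pigeonhole along a segment: the distance to the lattice is continuous, so a point far from the lattice gives many points on the segment whose pairwise
  differences are far from the lattice.

  Now \<open>Bad A \<epsilon>\<close> is a countable union of bounded sets \<open>E\<close> on which the defining inequality holds from a
  common threshold on. The \<open>q\<close> above can be chosen of norm comparable to \<open>2\<^sup>l\<close>, hence beyond the threshold
  for large \<open>l\<close>, and then \<open>E\<close> avoids a ball of radius comparable to \<open>\<beta>\<^sup>l\<close> around \<open>A q + p\<close>. So \<open>E\<close> is
  porous at every large good scale, with constants that do not depend on \<open>E\<close> (\<open>Bad_from_porous\<close>).

  Porosity at one scale shrinks the volume of the neighbourhoods of \<open>E\<close> by a fixed factor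
  (\<open>measure_nbhd_porous\<close>). Since good scales have positive upper density, for infinitely many \<open>N\<close> the
  volume of the \<open>\<beta>\<^sup>N\<close>-neighbourhood is exponentially small in \<open>N\<close>. Hence the lower box dimension of
  \<open>E\<close>, and with it the Hausdorff dimension, is below \<open>m\<close> by an amount depending only on the constants
  (\<open>hausdorff_dim_mean_porous\<close>), and a countable union keeps this bound.
\<close>

section \<open>Neighbourhoods of porous sets\<close>

text \<open>The open \<open>r\<close>-neighbourhood of a set.\<close>

definition nbhd :: "'a::metric_space set \<Rightarrow> real \<Rightarrow> 'a set" where
  "nbhd E r = (\<Union>x\<in>E. ball x r)"

lemma nbhd_mono: "r \<le> s \<Longrightarrow> nbhd E r \<subseteq> nbhd E s"
  by (force simp: nbhd_def)

lemma lmeasurable_nbhd: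
  fixes E :: "'a::euclidean_space set"
  assumes "bounded E"
  shows "nbhd E r \<in> lmeasurable"
proof (rule lmeasurable_open)
  obtain B where B: "\<And>x. x \<in> E \<Longrightarrow> norm x \<le> B"
    using assms by (auto simp: bounded_iff)
  show "bounded (nbhd E r)"
    unfolding bounded_iff nbhd_def
  proof (intro exI ballI)
    fix y assume "y \<in> (\<Union>x\<in>E. ball x r)"
    then obtain x where x: "x \<in> E" "dist x y < r" by auto
    have "norm y \<le> norm x + dist x y"
      by (metis dist_commute dist_norm norm_triangle_sub)
    then show "norm y \<le> B + r" using B[OF x(1)] x(2) by linarith
  qed
qed (auto simp: nbhd_def)

lemma measure_union_disjoint_balls:
  fixes c :: "'b \<Rightarrow> 'a::euclidean_space"
  assumes "finite T" "0 \<le> r" "disjoint_family_on (\<lambda>x. ball (c x) r) T"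
  shows "measure lebesgue (\<Union>x\<in>T. ball (c x) r) =
    real (card T) * (unit_ball_vol (real DIM('a)) * r ^ DIM('a))"
proof -
  have "emeasure lborel (ball (c x) r) \<noteq> top" for x
    using emeasure_lborel_ball_finite[of "c x" r] by simp
  then have "measure lebesgue (\<Union>x\<in>T. ball (c x) r) = (\<Sum>x\<in>T. measure lebesgue (ball (c x) r))"
    using assms by (intro measure_finite_Union) auto
  also have "\<dots> = (\<Sum>x\<in>T. unit_ball_vol (real DIM('a)) * r ^ DIM('a))"
    using assms(2) by (intro sum.cong) (simp_all add: content_ball)
  finally show ?thesis by simp
qed

lemma separated_balls_disjoint:
  fixes T :: "'a::metric_space set"
  assumes "\<And>x y. x \<in> T \<Longrightarrow> y \<in> T \<Longrightarrow> x \<noteq> y \<Longrightarrow> 2 * r \<le> dist x y"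
  shows "disjoint_family_on (\<lambda>x. ball x r) T"
  unfolding disjoint_family_on_def
proof (intro ballI impI)
  fix x y assume xy: "x \<in> T" "y \<in> T" "x \<noteq> y"
  show "ball x r \<inter> ball y r = {}"
  proof (rule ccontr)
    assume "ball x r \<inter> ball y r \<noteq> {}"
    then obtain z where "dist x z < r" "dist y z < r" by auto
    moreover have "dist x y \<le> dist x z + dist y z"
      by (metis dist_commute dist_triangle)
    ultimately show False using assms[OF xy] by linarith
  qed
qed

text \<open>
  A maximal \<open>2r\<close>-separated subset of a bounded set is finite by volume comparison, and the
  balls of radius \<open>2r\<close> around it cover the set.
\<close>

lemma separated_net:
  fixes E :: "'a::euclidean_space set"
  assumes "bounded E" "0 < r"
  obtains T where "finite T" "T \<subseteq> E" "E \<subseteq> (\<Union>x\<in>T. ball x (2 * r))"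
    "disjoint_family_on (\<lambda>x. ball x r) T"
    "real (card T) * (unit_ball_vol (real DIM('a)) * r ^ DIM('a)) \<le> measure lebesgue (nbhd E r)"
proof -
  define v where "v = unit_ball_vol (real DIM('a)) * r ^ DIM('a)"
  have v: "v > 0" unfolding v_def using assms(2) by simp
  define sep where "sep T \<longleftrightarrow> finite T \<and> T \<subseteq> E \<and>
    (\<forall>x\<in>T. \<forall>y\<in>T. x \<noteq> y \<longrightarrow> 2 * r \<le> dist x y)" for T :: "'a set"
  have bound: "real (card T) * v \<le> measure lebesgue (nbhd E r)" if "sep T" for T
  proof -
    have "measure lebesgue (\<Union>x\<in>T. ball x r) = real (card T) * v"
      unfolding v_def using that assms(2)
      by (intro measure_union_disjoint_balls separated_balls_disjoint) (auto simp: sep_def)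
    moreover have "measure lebesgue (\<Union>x\<in>T. ball x r) \<le> measure lebesgue (nbhd E r)"
      using that lmeasurable_nbhd[OF assms(1)] lmeasurable_nbhd[of T r]
      by (intro measure_mono_fmeasurable) (auto simp: sep_def nbhd_def finite_imp_bounded)
    ultimately show ?thesis by simp
  qed
  have "\<exists>T. sep T \<and> (\<forall>S. sep S \<longrightarrow> card S \<le> card T)"
  proof (rule ex_has_greatest_nat[of sep "{}" card])
    show "sep {}" by (simp add: sep_def)
    show "\<forall>S. sep S \<longrightarrow> card S < Suc (nat \<lfloor>measure lebesgue (nbhd E r) / v\<rfloor>)"
      using bound v by (auto simp: less_Suc_eq_le le_nat_floor pos_le_divide_eq)
  qed
  then obtain T where T: "sep T" and maxi: "\<And>S. sep S \<Longrightarrow> card S \<le> card T" by auto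
  have "E \<subseteq> (\<Union>x\<in>T. ball x (2 * r))"
  proof
    fix y assume y: "y \<in> E"
    show "y \<in> (\<Union>x\<in>T. ball x (2 * r))"
    proof (rule ccontr)
      assume "y \<notin> (\<Union>x\<in>T. ball x (2 * r))"
      then have far: "2 * r \<le> dist x y" if "x \<in> T" for x using that by force
      then have "y \<notin> T" using assms(2) by force
      moreover have "sep (insert y T)"
        using T y far by (auto simp: sep_def dist_commute)
      ultimately show False using maxi[of "insert y T"] T by (simp add: sep_def)
    qed
  qed
  then show thesis
    using T bound[OF T] separated_balls_disjoint[of T r] that[of T] unfolding sep_def v_def by auto
qed

text \<open>
  The effect of one scale of porosity: if near every point of \<open>E\<close> there is a hole of radius
  \<open>2\<rho>\<close>, then the \<open>\<rho>\<close>-neighbourhood of \<open>E\<close> misses a proportion of the volume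
  of its \<open>r\<close>-neighbourhood that depends only on \<open>\<rho> / r\<close> and the dimension.
\<close>

lemma measure_nbhd_porous:
  fixes E :: "'a::euclidean_space set"
  assumes "bounded E" "0 < \<rho>" "\<rho> \<le> r"
    and hole: "\<And>b. b \<in> E \<Longrightarrow> \<exists>y. dist b y + \<rho> \<le> r \<and> ball y (2 * \<rho>) \<inter> E = {}"
  shows "measure lebesgue (nbhd E \<rho>) \<le>
    (1 - (\<rho> / (3 * r)) ^ DIM('a)) * measure lebesgue (nbhd E r)"
proof -
  let ?\<omega> = "unit_ball_vol (real DIM('a))"
  have r: "0 < r" using assms by linarith
  obtain T where T: "finite T" "T \<subseteq> E" "E \<subseteq> (\<Union>x\<in>T. ball x (2 * r))"
    "disjoint_family_on (\<lambda>x. ball x r) T"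
    using separated_net[OF assms(1) r] by metis
  obtain y where y: "\<And>b. b \<in> E \<Longrightarrow> dist b (y b) + \<rho> \<le> r"
    "\<And>b. b \<in> E \<Longrightarrow> ball (y b) (2 * \<rho>) \<inter> E = {}"
    using hole by metis
  define D where "D = (\<Union>x\<in>T. ball (y x) \<rho>)"
  have sub: "ball (y x) \<rho> \<subseteq> ball x r" if "x \<in> T" for x
  proof
    fix z assume "z \<in> ball (y x) \<rho>"
    then show "z \<in> ball x r"
      using y(1)[of x] that T(2) dist_triangle[of x z "y x"] by auto
  qed
  have "disjoint_family_on (\<lambda>x. ball (y x) \<rho>) T"
    using T(4) sub unfolding disjoint_family_on_def by blast
  then have D: "measure lebesgue D = real (card T) * (?\<omega> * \<rho> ^ DIM('a))"
    unfolding D_def using T(1) assms(2) by (intro measure_union_disjoint_balls) auto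
  have D_meas: "D \<in> lmeasurable"
    unfolding D_def using T(1) by (intro fmeasurable.finite_UN) auto
  have D_nbhd: "D \<inter> nbhd E \<rho> = {}"
  proof (rule ccontr)
    assume "D \<inter> nbhd E \<rho> \<noteq> {}"
    then obtain x z e where "x \<in> T" "dist (y x) z < \<rho>" "e \<in> E" "dist e z < \<rho>"
      by (auto simp: D_def nbhd_def)
    moreover then have "dist (y x) e < 2 * \<rho>"
      using dist_triangle[of "y x" e z] by (simp add: dist_commute)
    ultimately show False using y(2)[of x] T(2) by (auto simp: disjoint_iff)
  qed
  have "D \<subseteq> nbhd E r" using sub T(2) unfolding D_def nbhd_def by blast
  then have "measure lebesgue (D \<union> nbhd E \<rho>) \<le> measure lebesgue (nbhd E r)"
    using D_meas lmeasurable_nbhd[OF assms(1)] nbhd_mono[OF assms(3), of E]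
    by (intro measure_mono_fmeasurable) auto
  moreover have "measure lebesgue (D \<union> nbhd E \<rho>) = measure lebesgue D + measure lebesgue (nbhd E \<rho>)"
    using D_meas lmeasurable_nbhd[OF assms(1)] D_nbhd by (intro measure_Un3[THEN trans]) auto
  ultimately have 1: "measure lebesgue D + measure lebesgue (nbhd E \<rho>) \<le> measure lebesgue (nbhd E r)"
    by simp
  have "nbhd E r \<subseteq> (\<Union>x\<in>T. ball x (3 * r))"
  proof
    fix z assume "z \<in> nbhd E r"
    then obtain e where e: "e \<in> E" "dist e z < r" by (auto simp: nbhd_def)
    then obtain x where "x \<in> T" "dist x e < 2 * r" using T(3) by auto
    then show "z \<in> (\<Union>x\<in>T. ball x (3 * r))" using e(2) dist_triangle[of x z e] by force
  qed
  then have "measure lebesgue (nbhd E r) \<le> measure lebesgue (\<Union>x\<in>T. ball x (3 * r))"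
    using lmeasurable_nbhd[OF assms(1)] T(1)
    by (intro measure_mono_fmeasurable fmeasurable.finite_UN) auto
  also have "\<dots> \<le> (\<Sum>x\<in>T. measure lebesgue (ball x (3 * r)))"
    using T(1) by (intro measure_UNION_le) auto
  also have "\<dots> = real (card T) * (?\<omega> * (3 * r) ^ DIM('a))"
    using r by (simp add: content_ball)
  finally have 2: "measure lebesgue (nbhd E r) \<le> real (card T) * (?\<omega> * (3 * r) ^ DIM('a))" .
  have "(\<rho> / (3 * r)) ^ DIM('a) * measure lebesgue (nbhd E r) \<le>
     (\<rho> / (3 * r)) ^ DIM('a) * (real (card T) * (?\<omega> * (3 * r) ^ DIM('a)))"
    using 2 assms(2) r by (intro mult_left_mono) auto
  also have "\<dots> = measure lebesgue D"
    using D r by (simp add: power_divide)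
  finally show ?thesis using 1 by (simp add: algebra_simps)
qed


section \<open>Sets of Hausdorff measure zero\<close>

lemma hausdorff_measure_eq_0I:
  assumes "\<And>\<delta> \<eta>. 0 < \<delta> \<Longrightarrow> 0 < \<eta> \<Longrightarrow>
    \<exists>U\<in>delta_covers \<delta> S. (\<Sum>i. hausdorff_weight s (U i)) \<le> ennreal \<eta>"
  shows "hausdorff_measure s S = 0"
proof -
  have "hausdorff_premeasure s \<delta> S \<le> 0" if pos: "0 < \<delta>" for \<delta>
  proof (rule ennreal_le_epsilon)
    fix \<eta> :: real assume "0 < \<eta>"
    then obtain U where U: "U \<in> delta_covers \<delta> S" "(\<Sum>i. hausdorff_weight s (U i)) \<le> ennreal \<eta>"
      using assms[OF pos] by blast
    from U(1) have "hausdorff_premeasure s \<delta> S \<le> (\<Sum>i. hausdorff_weight s (U i))"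
      unfolding hausdorff_premeasure_def by (rule INF_lower)
    also note U(2)
    finally show "hausdorff_premeasure s \<delta> S \<le> 0 + ennreal \<eta>"
      by simp
  qed
  then have "hausdorff_measure s S \<le> 0"
    unfolding hausdorff_measure_def by (intro SUP_least) auto
  then show ?thesis by simp
qed

lemma hausdorff_measure_UN_eq_0I:
  fixes E :: "nat \<Rightarrow> 'a::metric_space set"
  assumes "\<And>k \<delta> \<eta>. 0 < \<delta> \<Longrightarrow> 0 < \<eta> \<Longrightarrow>
    \<exists>U\<in>delta_covers \<delta> (E k). (\<Sum>i. hausdorff_weight s (U i)) \<le> ennreal \<eta>"
  shows "hausdorff_measure s (\<Union>k. E k) = 0"
proof (rule hausdorff_measure_eq_0I)
  fix \<delta> \<eta> :: real assume pos: "0 < \<delta>" "0 < \<eta>"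
  have "\<exists>U\<in>delta_covers \<delta> (E k). (\<Sum>i. hausdorff_weight s (U i)) \<le> ennreal (\<eta> * (1/2) ^ Suc k)" for k
    using pos by (intro assms) auto
  then obtain U where U: "\<And>k. U k \<in> delta_covers \<delta> (E k)"
    "\<And>k. (\<Sum>i. hausdorff_weight s (U k i)) \<le> ennreal (\<eta> * (1/2) ^ Suc k)"
    by metis
  define V where "V i = case_prod U (prod_decode i)" for i
  have "(\<Union>k. E k) \<subseteq> (\<Union>i. V i)"
  proof
    fix x assume "x \<in> (\<Union>k. E k)"
    then obtain k i where "x \<in> U k i" using U(1) by (fastforce simp: delta_covers_def)
    then have "x \<in> V (prod_encode (k, i))" by (simp add: V_def)
    then show "x \<in> (\<Union>i. V i)" by blast
  qed
  moreover have "bounded (V i) \<and> diameter (V i) \<le> \<delta>" for i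
    using U(1) by (simp add: V_def delta_covers_def split: prod.split)
  ultimately have "V \<in> delta_covers \<delta> (\<Union>k. E k)"
    by (simp add: delta_covers_def)
  moreover have "(\<Sum>i. hausdorff_weight s (V i)) \<le> ennreal \<eta>"
  proof -
    have "(\<Sum>i. hausdorff_weight s (V i)) =
      (\<Sum>i. (\<lambda>(k, i). hausdorff_weight s (U k i)) (prod_decode i))"
      by (simp add: V_def case_prod_beta)
    also have "\<dots> = (\<Sum>k. \<Sum>i. hausdorff_weight s (U k i))"
      by (intro suminf_ennreal_2dimen) simp
    also have "\<dots> \<le> (\<Sum>k. ennreal (\<eta> * (1/2) ^ Suc k))"
      by (intro suminf_le U(2)) auto
    also have "\<dots> = ennreal \<eta>"
      using pos(2) power_half_series[THEN sums_mult, of \<eta>]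
      by (intro suminf_ennreal_eq) auto
    finally show ?thesis .
  qed
  ultimately show "\<exists>V\<in>delta_covers \<delta> (\<Union>k. E k). (\<Sum>i. hausdorff_weight s (V i)) \<le> ennreal \<eta>"
    by blast
qed

lemma delta_cover_by_balls:
  fixes E :: "'a::euclidean_space set"
  assumes "finite T" "E \<subseteq> (\<Union>x\<in>T. ball x r)" "0 \<le> r" "2 * r \<le> \<delta>" "0 < s"
  shows "\<exists>U\<in>delta_covers \<delta> E. (\<Sum>i. hausdorff_weight s (U i)) \<le> ennreal (real (card T) * (2 * r) powr s)"
proof -
  obtain e where e: "bij_betw e {0..<card T} T"
    using ex_bij_betw_nat_finite[OF assms(1)] by blast
  define U where "U i = (if i < card T then ball (e i) r else {})" for i
  have "E \<subseteq> (\<Union>i. U i)"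
  proof
    fix x assume "x \<in> E"
    then obtain y where y: "y \<in> T" "x \<in> ball y r" using assms(2) by blast
    then obtain i where "i < card T" "e i = y"
      using bij_betw_imp_surj_on[OF e] by (metis atLeastLessThan_iff imageE)
    then have "x \<in> U i" using y by (simp add: U_def)
    then show "x \<in> (\<Union>i. U i)" by blast
  qed
  then have "U \<in> delta_covers \<delta> E"
    using assms(3,4) by (auto simp: delta_covers_def U_def)
  moreover have "(\<Sum>i. hausdorff_weight s (U i)) \<le> ennreal (real (card T) * (2 * r) powr s)"
  proof -
    have "(\<Sum>i. hausdorff_weight s (U i)) = (\<Sum>i<card T. hausdorff_weight s (U i))"
      by (intro suminf_finite) (auto simp: U_def hausdorff_weight_def)
    also have "\<dots> \<le> (\<Sum>i<card T. ennreal ((2 * r) powr s))"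
      using assms(3,5) by (intro sum_mono) (auto simp: U_def hausdorff_weight_def)
    also have "\<dots> = ennreal (real (card T) * (2 * r) powr s)"
      by (simp add: ennreal_mult ennreal_of_nat_eq_real_of_nat)
    finally show ?thesis .
  qed
  ultimately show ?thesis by blast
qed


section \<open>Hausdorff dimension of mean porous sets\<close>

text \<open>
  A window of \<open>P\<close> consecutive values absorbs the delay \<open>P\<close> in the decay hypothesis: when the window
  moves one step, exactly one factor \<open>F l\<close> is replaced by \<open>F (l + P)\<close>.
\<close>

lemma delayed_decay:
  fixes F :: "nat \<Rightarrow> real"
  assumes nonneg: "\<And>l. 0 \<le> F l" and anti: "antimono F"
    and \<theta>: "0 < \<theta>" "\<theta> \<le> 1" and P: "0 < P"
    and decay: "\<And>l. l \<in> G \<Longrightarrow> l1 \<le> l \<Longrightarrow> F (l + P) \<le> \<theta> * F l"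
  shows "\<exists>C>0. \<forall>N\<ge>l1. F (N + P) ^ P \<le> C * \<theta> ^ card (G \<inter> {1..N})"
proof -
  obtain P' where P': "P = Suc P'" using P by (cases P) auto
  define \<Phi> where "\<Phi> N = (\<Prod>i<P. F (N + 1 + i))" for N
  define C where "C = (\<Phi> l1 + 1) / \<theta> ^ card (G \<inter> {1..l1})"
  have \<Phi>0: "0 \<le> \<Phi> N" for N unfolding \<Phi>_def by (intro prod_nonneg) (use nonneg in auto)
  have C: "0 < C" unfolding C_def using \<Phi>0[of l1] \<theta> by (intro divide_pos_pos) auto
  have main: "\<Phi> N \<le> C * \<theta> ^ card (G \<inter> {1..N})" if "l1 \<le> N" for N
    using that
  proof (induction N rule: dec_induct)
    case base
    then show ?case using \<theta> by (simp add: C_def)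
  next
    case (step N)
    define M where "M = (\<Prod>i<P'. F (N + 2 + i))"
    have M: "0 \<le> M" unfolding M_def by (intro prod_nonneg) (use nonneg in auto)
    have 1: "\<Phi> N = F (Suc N) * M"
      unfolding \<Phi>_def M_def P' by (subst prod.lessThan_Suc_shift) simp
    have 2: "\<Phi> (Suc N) = F (Suc N + P) * M"
      unfolding \<Phi>_def M_def P' by (simp add: mult.commute)
    have int: "{1..Suc N} = insert (Suc N) {1..N}" by auto
    show ?case
    proof (cases "Suc N \<in> G")
      case True
      have "\<Phi> (Suc N) \<le> \<theta> * \<Phi> N"
        unfolding 1 2 using mult_right_mono[OF decay[OF True] M] step by simp
      also have "\<dots> \<le> \<theta> * (C * \<theta> ^ card (G \<inter> {1..N}))"
        using step.IH \<theta> by (intro mult_left_mono) auto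
      also have "\<dots> = C * \<theta> ^ card (G \<inter> {1..Suc N})"
        unfolding int using True by simp
      finally show ?thesis .
    next
      case False
      have "\<Phi> (Suc N) \<le> \<Phi> N"
        unfolding 1 2 using M anti by (intro mult_right_mono) (auto simp: antimono_def)
      then show ?thesis using step.IH False unfolding int by simp
    qed
  qed
  have "F (N + P) ^ P \<le> \<Phi> N" for N
  proof -
    have "(\<Prod>i<P. F (N + P)) \<le> \<Phi> N"
      unfolding \<Phi>_def using nonneg anti by (intro prod_mono) (auto simp: antimono_def)
    then show ?thesis by simp
  qed
  then show ?thesis using main C by (meson order_trans)
qed

text \<open>
  A countable union of sets that are porous, with common constants, at a set of scales of positive upper
  density has Hausdorff dimension below that of the space. How early the porosity starts may depend on
  the set: finitely many scales only affect a multiplicative constant.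
\<close>

lemma hausdorff_dim_mean_porous:
  fixes E :: "nat \<Rightarrow> 'a::euclidean_space set" and G :: "nat set"
  assumes bdd: "\<And>k. bounded (E k)" and \<beta>: "0 < \<beta>" "\<beta> < 1"
    and K: "0 < K" and \<kappa>: "0 < \<kappa>" and \<delta>: "0 < \<delta>"
    and density: "\<exists>\<^sub>\<infinity>N. \<delta> * real N \<le> real (card (G \<inter> {1..N}))"
    and porous: "\<And>k. \<exists>l1. \<forall>l\<in>G. l1 \<le> l \<longrightarrow>
      (\<forall>b\<in>E k. \<exists>y. dist b y \<le> K * \<beta> ^ l \<and> ball y (\<kappa> * \<beta> ^ l) \<inter> E k = {})"
  shows "hausdorff_dim (\<Union>k. E k) < of_nat DIM('a)"
proof -
  define D where "D = DIM('a)"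
  define \<omega> where "\<omega> = unit_ball_vol (real D)"
  have \<omega>: "0 < \<omega>" by (simp add: \<omega>_def)
  have D: "1 \<le> D" by (simp add: D_def Suc_leI)
  define r where "r l = (K + \<kappa>) * \<beta> ^ l" for l
  have r: "0 < r l" for l using \<beta> K \<kappa> by (simp add: r_def)
  define \<theta> where "\<theta> = 1 - (\<kappa> / (6 * (K + \<kappa>))) ^ D"
  have "0 < \<kappa> / (6 * (K + \<kappa>))" "\<kappa> / (6 * (K + \<kappa>)) < 1"
    using K \<kappa> by (auto simp: field_simps)
  then have "(\<kappa> / (6 * (K + \<kappa>))) ^ D < 1" "0 < (\<kappa> / (6 * (K + \<kappa>))) ^ D"
    using D power_less_one_iff[of "\<kappa> / (6 * (K + \<kappa>))" D] by auto
  then have \<theta>: "0 < \<theta>" "\<theta> < 1" by (auto simp: \<theta>_def)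
  \<comment> \<open>\<open>P\<close> scales further, the radius of the neighbourhoods is less than half that of the holes.\<close>
  have "\<exists>P. (K + \<kappa>) * \<beta> ^ P < \<kappa> / 2 \<and> 0 < P"
  proof -
    have "(\<lambda>P. (K + \<kappa>) * \<beta> ^ P) \<longlonglongrightarrow> (K + \<kappa>) * 0"
      using \<beta> by (intro tendsto_mult tendsto_const LIMSEQ_realpow_zero) auto
    then have "\<forall>\<^sub>F P in sequentially. (K + \<kappa>) * \<beta> ^ P < \<kappa> / 2"
      using \<kappa> by (intro order_tendstoD) auto
    then have "\<forall>\<^sub>F P in sequentially. (K + \<kappa>) * \<beta> ^ P < \<kappa> / 2 \<and> 0 < P"
      using eventually_gt_at_top[of 0] by (rule eventually_conj)
    then show ?thesis by (rule eventually_happens'[OF sequentially_bot])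
  qed
  then obtain P where P: "(K + \<kappa>) * \<beta> ^ P < \<kappa> / 2" "0 < P" by blast
  define F where "F k l = measure lebesgue (nbhd (E k) (r l))" for k l
  have F_decay: "\<exists>C>0. \<exists>l1. \<forall>N\<ge>l1. F k (N + P) ^ P \<le> C * \<theta> ^ card (G \<inter> {1..N})" for k
  proof -
    obtain l1 where l1: "\<And>l b. l \<in> G \<Longrightarrow> l1 \<le> l \<Longrightarrow> b \<in> E k \<Longrightarrow>
      \<exists>y. dist b y \<le> K * \<beta> ^ l \<and> ball y (\<kappa> * \<beta> ^ l) \<inter> E k = {}"
      using porous[of k] by blast
    have mono: "measure lebesgue (nbhd (E k) s) \<le> measure lebesgue (nbhd (E k) t)" if "s \<le> t" for s t
      using nbhd_mono[OF that] lmeasurable_nbhd[OF bdd] by (intro measure_mono_fmeasurable) auto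
    have "F k (l + P) \<le> \<theta> * F k l" if l: "l \<in> G" "l1 \<le> l" for l
    proof -
      let ?\<rho> = "\<kappa> * \<beta> ^ l / 2"
      have "r (l + P) \<le> ?\<rho>"
        using mult_right_mono[OF less_imp_le[OF P(1)], of "\<beta> ^ l"] \<beta>
        by (simp add: r_def power_add mult_ac)
      then have "F k (l + P) \<le> measure lebesgue (nbhd (E k) ?\<rho>)"
        unfolding F_def by (rule mono)
      also have "\<dots> \<le> (1 - (?\<rho> / (3 * r l)) ^ DIM('a)) * measure lebesgue (nbhd (E k) (r l))"
      proof (rule measure_nbhd_porous[OF bdd])
        show "0 < ?\<rho>" using \<kappa> \<beta> by simp
        show "?\<rho> \<le> r l" using K \<kappa> \<beta> by (simp add: r_def field_simps)
        fix b assume "b \<in> E k"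
        then obtain y where "dist b y \<le> K * \<beta> ^ l" "ball y (\<kappa> * \<beta> ^ l) \<inter> E k = {}"
          using l1 l by blast
        moreover have "0 \<le> ?\<rho>" using \<kappa> \<beta> by simp
        ultimately show "\<exists>y. dist b y + ?\<rho> \<le> r l \<and> ball y (2 * ?\<rho>) \<inter> E k = {}"
          by (intro exI[of _ y]) (auto simp: r_def algebra_simps)
      qed
      also have "?\<rho> / (3 * r l) = \<kappa> / (6 * (K + \<kappa>))"
        using \<beta> by (simp add: r_def)
      finally show ?thesis by (simp add: \<theta>_def F_def D_def)
    qed
    moreover have "antimono (F k)"
    proof (rule antimonoI)
      fix l l' :: nat assume "l \<le> l'"
      then have "r l' \<le> r l"
        unfolding r_def using \<beta> K \<kappa> by (intro mult_left_mono power_decreasing) auto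
      then show "F k l' \<le> F k l" unfolding F_def by (rule mono)
    qed
    moreover have "0 \<le> F k l" for l by (simp add: F_def)
    ultimately have "\<exists>C>0. \<forall>N\<ge>l1. F k (N + P) ^ P \<le> C * \<theta> ^ card (G \<inter> {1..N})"
      using \<theta> P(2) by (intro delayed_decay) simp_all
    then show ?thesis by blast
  qed
  define \<mu> where "\<mu> = \<theta> powr (\<delta> / real P)"
  have \<mu>: "0 < \<mu>" "\<mu> < 1"
    using \<theta> \<delta> P(2) powr_less_mono2[of "\<delta> / real P" \<theta> 1] by (auto simp: \<mu>_def)
  \<comment> \<open>A small loss \<open>t\<close> in the exponent is compensated by the decay rate \<open>\<mu>\<close>.\<close>
  have "\<exists>t. 0 < t \<and> t < 1 \<and> \<mu> * \<beta> powr (- t) < 1"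
  proof -
    have "((\<lambda>t. \<mu> * \<beta> powr (- t)) \<longlongrightarrow> \<mu> * \<beta> powr (- 0)) (at_right 0)"
      using \<beta> by (intro tendsto_intros) auto
    then have "\<forall>\<^sub>F t in at_right 0. \<mu> * \<beta> powr (- t) < 1"
      using \<mu> \<beta> by (intro order_tendstoD) auto
    moreover have "\<forall>\<^sub>F t in at_right 0. 0 < t \<and> t < (1::real)"
      by (auto simp: eventually_at_right_field intro!: exI[of _ 1])
    ultimately have "\<forall>\<^sub>F t in at_right 0. (0 < t \<and> t < 1) \<and> \<mu> * \<beta> powr (- t) < 1"
      by eventually_elim blast
    from eventually_happens'[OF trivial_limit_at_right_real this] show ?thesis by blast
  qed
  then obtain t where t: "0 < t" "t < 1" "\<mu> * \<beta> powr (- t) < 1" by blast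
  define s where "s = real D - t"
  have s: "0 < s" "s < real D" using t D by (auto simp: s_def)
  have "hausdorff_measure s (\<Union>k. E k) = 0"
  proof (rule hausdorff_measure_UN_eq_0I)
    fix k and \<delta>' \<eta> :: real assume pos: "0 < \<delta>'" "0 < \<eta>"
    obtain C l1 where C: "0 < C" "\<And>N. l1 \<le> N \<Longrightarrow> F k (N + P) ^ P \<le> C * \<theta> ^ card (G \<inter> {1..N})"
      using F_decay[of k] by blast
    define C' where "C' = C powr (1 / real P) / \<omega> * 4 powr s * ((K + \<kappa>) * \<beta> ^ P) powr (- t)"
    define q where "q = \<mu> * \<beta> powr (- t)"
    have q: "0 < q" "q < 1" using \<mu> \<beta> t by (auto simp: q_def)
    have "(\<lambda>N. C' * q ^ N) \<longlonglongrightarrow> C' * 0"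
      using q by (intro tendsto_mult tendsto_const LIMSEQ_realpow_zero) auto
    then have ev1: "\<forall>\<^sub>F N in sequentially. C' * q ^ N < \<eta>"
      using pos by (intro order_tendstoD) auto
    have "(\<lambda>N. 4 * ((K + \<kappa>) * \<beta> ^ P * \<beta> ^ N)) \<longlonglongrightarrow> 4 * ((K + \<kappa>) * \<beta> ^ P * 0)"
      using \<beta> by (intro tendsto_mult tendsto_const LIMSEQ_realpow_zero) auto
    then have ev2: "\<forall>\<^sub>F N in sequentially. 4 * ((K + \<kappa>) * \<beta> ^ P * \<beta> ^ N) < \<delta>'"
      using pos by (intro order_tendstoD) auto
    have "\<exists>\<^sub>\<infinity>N. \<delta> * real N \<le> real (card (G \<inter> {1..N})) \<and>
      (C' * q ^ N < \<eta> \<and> 4 * ((K + \<kappa>) * \<beta> ^ P * \<beta> ^ N) < \<delta>' \<and> l1 \<le> N)"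
      using density ev1 ev2 eventually_ge_at_top[of l1]
      by (intro INFM_conjI) (auto simp: cofinite_eq_sequentially eventually_conj_iff)
    then obtain N where N: "\<delta> * real N \<le> real (card (G \<inter> {1..N}))" "C' * q ^ N < \<eta>"
      "4 * ((K + \<kappa>) * \<beta> ^ P * \<beta> ^ N) < \<delta>'" "l1 \<le> N"
      by (auto dest: INFM_EX)
    let ?r = "r (N + P)"
    have r_eq: "?r = (K + \<kappa>) * \<beta> ^ P * \<beta> ^ N" by (simp add: r_def power_add)
    have F0: "0 \<le> F k (N + P)" by (simp add: F_def)
    have F_le: "F k (N + P) \<le> C powr (1 / real P) * \<mu> ^ N"
    proof -
      have "F k (N + P) = (F k (N + P) ^ P) powr (1 / real P)"
        using F0 P(2) by (simp add: powr_realpow' [symmetric] powr_powr)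
      also have "\<dots> \<le> (C * \<theta> ^ card (G \<inter> {1..N})) powr (1 / real P)"
        using C(2)[OF N(4)] F0 by (intro powr_mono2) auto
      also have "\<theta> ^ card (G \<inter> {1..N}) = \<theta> powr real (card (G \<inter> {1..N}))"
        using \<theta> by (simp add: powr_realpow)
      also have "(C * \<dots>) powr (1 / real P) \<le> (C * \<theta> powr (\<delta> * real N)) powr (1 / real P)"
        using C(1) \<theta> N(1) by (intro powr_mono2 mult_left_mono powr_mono') auto
      also have "\<dots> = C powr (1 / real P) * \<mu> ^ N"
        using C(1) \<theta> \<mu> by (simp add: \<mu>_def powr_mult powr_powr powr_realpow[symmetric] field_simps)
      finally show ?thesis .
    qed
    obtain T where T: "finite T" "E k \<subseteq> (\<Union>x\<in>T. ball x (2 * ?r))"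
      "real (card T) * (\<omega> * ?r ^ D) \<le> F k (N + P)"
      using separated_net[OF bdd r, of k "N + P"] unfolding \<omega>_def D_def F_def by metis
    obtain U where U: "U \<in> delta_covers \<delta>' (E k)"
      "(\<Sum>i. hausdorff_weight s (U i)) \<le> ennreal (real (card T) * (2 * (2 * ?r)) powr s)"
      using delta_cover_by_balls[OF T(1,2), of \<delta>' s] r[of "N + P"] N(3) s(1) r_eq by auto
    have "real (card T) * (2 * (2 * ?r)) powr s \<le> F k (N + P) / (\<omega> * ?r ^ D) * (4 * ?r) powr s"
      using T(3) \<omega> r[of "N + P"] by (intro mult_mono) (auto simp: pos_le_divide_eq F0)
    also have "\<dots> = F k (N + P) / \<omega> * 4 powr s * ?r powr (- t)"
      using r[of "N + P"] by (simp add: s_def powr_mult powr_diff powr_realpow powr_minus field_simps)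
    also have "\<dots> \<le> C powr (1 / real P) * \<mu> ^ N / \<omega> * 4 powr s * ?r powr (- t)"
      using F_le \<omega> by (intro mult_right_mono divide_right_mono) auto
    also have "\<dots> = C' * q ^ N"
    proof -
      have "?r powr (- t) = ((K + \<kappa>) * \<beta> ^ P) powr (- t) * (\<beta> powr (- t)) ^ N"
        unfolding r_eq using \<beta> K \<kappa>
        by (subst powr_mult) (auto simp: powr_realpow[symmetric] powr_powr mult.commute)
      then show ?thesis by (simp add: C'_def q_def power_mult_distrib field_simps)
    qed
    also have "\<dots> \<le> \<eta>" using N(2) by simp
    finally have "(\<Sum>i. hausdorff_weight s (U i)) \<le> ennreal \<eta>"
      using U(2) by (meson ennreal_leI order_trans)
    then show "\<exists>U\<in>delta_covers \<delta>' (E k). (\<Sum>i. hausdorff_weight s (U i)) \<le> ennreal \<eta>"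
      using U(1) by blast
  qed
  then have "hausdorff_dim (\<Union>k. E k) \<le> ennreal s"
    unfolding hausdorff_dim_def using s by (intro INF_lower) auto
  also have "ennreal s < ennreal (real D)"
    using s by (intro ennreal_lessI) auto
  finally show ?thesis by (simp add: D_def ennreal_of_nat_eq_real_of_nat)
qed


section \<open>Bounded covering radius\<close>

lemma integer_vectors_0 [simp]: "0 \<in> integer_vectors"
  by (simp add: integer_vectors_def)

lemma integer_vectors_add: "p \<in> integer_vectors \<Longrightarrow> q \<in> integer_vectors \<Longrightarrow> p + q \<in> integer_vectors"
  by (simp add: integer_vectors_def)

lemma integer_vectors_diff: "p \<in> integer_vectors \<Longrightarrow> q \<in> integer_vectors \<Longrightarrow> p - q \<in> integer_vectors"
  by (simp add: integer_vectors_def)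

lemma integer_vectors_minus: "p \<in> integer_vectors \<Longrightarrow> - p \<in> integer_vectors"
  by (simp add: integer_vectors_def)

lemma dist_to_integers_le: "p \<in> integer_vectors \<Longrightarrow> dist_to_integers v \<le> norm (v - p)"
  unfolding dist_to_integers_def by (rule cINF_lower) (auto intro: bdd_belowI2[of _ 0])

lemma norm_less_card_times:
  fixes x :: "real ^ 'k"
  assumes "\<And>i. \<bar>x $ i\<bar> < c"
  shows "norm x < real CARD('k) * c"
proof -
  have "norm x \<le> (\<Sum>i\<in>UNIV. \<bar>x $ i\<bar>)" by (rule norm_le_l1_cart)
  also have "\<dots> < (\<Sum>i\<in>(UNIV :: 'k set). c)"
    using assms by (intro sum_strict_mono) auto
  finally show ?thesis by simp
qed

text \<open>
  The gauge of \<open>x\<close> measures how well \<open>x\<close> is approximated by the group of all \<open>A q + p\<close> with integral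
  \<open>q\<close> and \<open>p\<close>, on the scales \<open>R\<close> for \<open>q\<close> and \<open>\<rho>\<close> for the error: it is the distance of \<open>(x, 0)\<close> to the
  lattice of the points \<open>(A q + p, q)\<close>, for a norm adapted to the two scales. As a function of \<open>x\<close> it is
  subadditive and Lipschitz.
\<close>

definition gauge_mod :: "real ^ 'n ^ 'm \<Rightarrow> real \<Rightarrow> real \<Rightarrow> real ^ 'm \<Rightarrow> real" where
  "gauge_mod A R \<rho> x = (INF (q, p)\<in>integer_vectors \<times> integer_vectors.
     max (norm q / R) (norm (x - (A *v q + p)) / \<rho>))"

context
  fixes A :: "real ^ 'n ^ 'm" and R \<rho> :: real
  assumes pos: "0 < R" "0 < \<rho>"
begin

lemma bdd_below_gauge_mod:
  "bdd_below ((\<lambda>(q, p). max (norm q / R) (norm (x - (A *v q + p)) / \<rho>)) `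
     (integer_vectors \<times> integer_vectors))"
  using pos by (intro bdd_belowI2[of _ 0]) (auto simp: le_max_iff_disj)

lemma gauge_mod_le:
  assumes "q \<in> integer_vectors" "p \<in> integer_vectors"
  shows "gauge_mod A R \<rho> x \<le> max (norm q / R) (norm (x - (A *v q + p)) / \<rho>)"
  unfolding gauge_mod_def
  using cINF_lower[OF bdd_below_gauge_mod, of "(q, p)" x] assms by simp

lemma gauge_mod_lessE:
  assumes "gauge_mod A R \<rho> x < c"
  obtains q p where "q \<in> integer_vectors" "p \<in> integer_vectors"
    "norm q / R < c" "norm (x - (A *v q + p)) / \<rho> < c"
proof -
  have ne: "integer_vectors \<times> integer_vectors \<noteq> ({} :: ((real ^ 'n) \<times> (real ^ 'm)) set)"
    by (metis SigmaI emptyE integer_vectors_0)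
  obtain z where "z \<in> integer_vectors \<times> integer_vectors"
    "(\<lambda>(q, p). max (norm q / R) (norm (x - (A *v q + p)) / \<rho>)) z < c"
    using assms unfolding gauge_mod_def cINF_less_iff[OF ne bdd_below_gauge_mod] by blast
  then show thesis using that by (cases z) auto
qed

lemma gauge_mod_le_1:
  assumes "q \<in> integer_vectors" "p \<in> integer_vectors"
    and "norm q < R" "norm (x - (A *v q + p)) < \<rho>"
  shows "gauge_mod A R \<rho> x \<le> 1"
proof -
  have "norm q / R \<le> 1" "norm (x - (A *v q + p)) / \<rho> \<le> 1"
    using assms(3,4) pos by (simp_all add: pos_divide_le_eq)
  then show ?thesis using gauge_mod_le[OF assms(1,2), of x] by linarith
qed

lemma gauge_mod_nonneg: "0 \<le> gauge_mod A R \<rho> x"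
proof (rule ccontr)
  assume "\<not> ?thesis"
  then obtain q :: "real ^ 'n" where "norm q / R < 0"
    using gauge_mod_lessE[of x 0] by (metis not_le)
  then show False using pos by (simp add: divide_less_0_iff)
qed

lemma gauge_mod_add: "gauge_mod A R \<rho> (x + y) \<le> gauge_mod A R \<rho> x + gauge_mod A R \<rho> y"
proof (rule field_le_epsilon)
  fix e :: real assume "0 < e"
  obtain q p where 1: "q \<in> integer_vectors" "p \<in> integer_vectors"
    "norm q / R < gauge_mod A R \<rho> x + e / 2"
    "norm (x - (A *v q + p)) / \<rho> < gauge_mod A R \<rho> x + e / 2"
    using gauge_mod_lessE[of x "gauge_mod A R \<rho> x + e / 2"] \<open>0 < e\<close> by auto
  obtain q' p' where 2: "q' \<in> integer_vectors" "p' \<in> integer_vectors"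
    "norm q' / R < gauge_mod A R \<rho> y + e / 2"
    "norm (y - (A *v q' + p')) / \<rho> < gauge_mod A R \<rho> y + e / 2"
    using gauge_mod_lessE[of y "gauge_mod A R \<rho> y + e / 2"] \<open>0 < e\<close> by auto
  have "norm (q + q') / R \<le> norm q / R + norm q' / R"
    using pos norm_triangle_ineq[of q q'] by (simp add: divide_right_mono flip: add_divide_distrib)
  moreover have "norm (x + y - (A *v (q + q') + (p + p'))) / \<rho> \<le>
    norm (x - (A *v q + p)) / \<rho> + norm (y - (A *v q' + p')) / \<rho>"
    using pos norm_triangle_ineq[of "x - (A *v q + p)" "y - (A *v q' + p')"]
    by (simp add: divide_right_mono algebra_simps matrix_vector_right_distrib flip: add_divide_distrib)
  ultimately show "gauge_mod A R \<rho> (x + y) \<le> gauge_mod A R \<rho> x + gauge_mod A R \<rho> y + e"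
    using gauge_mod_le[of "q + q'" "p + p'" "x + y"] 1 2 by (simp add: integer_vectors_add max_def split: if_splits)
qed

lemma gauge_mod_le_norm: "gauge_mod A R \<rho> x \<le> norm x / \<rho>"
  using gauge_mod_le[of 0 0 x] pos by simp

lemma continuous_on_gauge_mod: "continuous_on S (gauge_mod A R \<rho>)"
proof (rule continuous_on_subset[OF lipschitz_on_continuous_on subset_UNIV])
  show "(1 / \<rho>)-lipschitz_on UNIV (gauge_mod A R \<rho>)"
  proof (rule lipschitz_onI)
    fix x y :: "real ^ 'm"
    have "gauge_mod A R \<rho> u - gauge_mod A R \<rho> v \<le> dist x y / \<rho>" if "{u, v} = {x, y}" for u v
    proof -
      have "gauge_mod A R \<rho> u \<le> gauge_mod A R \<rho> v + gauge_mod A R \<rho> (u - v)"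
        using gauge_mod_add[of v "u - v"] by simp
      also have "gauge_mod A R \<rho> (u - v) \<le> dist x y / \<rho>"
        using gauge_mod_le_norm[of "u - v"] that
        by (auto simp: dist_norm norm_minus_commute doubleton_eq_iff)
      finally show ?thesis by simp
    qed
    from this[of x y] this[of y x]
    show "dist (gauge_mod A R \<rho> x) (gauge_mod A R \<rho> y) \<le> 1 / \<rho> * dist x y"
      by (auto simp: dist_real_def abs_le_iff insert_commute)
  qed (use pos in simp)
qed

end

text \<open>
  If \<open>A q\<close> is at distance at least \<open>\<rho>\<close> from the integral vectors for all nonzero \<open>q\<close> of norm below \<open>R\<close>, the
  gauge is less than \<open>2 J + 1\<close>, where \<open>J\<close> is subject to the counting condition \<open>g\<^sup>m < J h\<^sup>n\<close>.
  Otherwise the segment from \<open>0\<close> to a point of large gauge contains \<open>J\<close> points \<open>x j\<close> with gauge \<open>2 j\<close>,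
  by the intermediate value theorem. The translates by \<open>x j\<close> of the points \<open>A q\<close>, with \<open>q\<close> in a box of side
  \<open>h\<close>, are then all \<open>\<rho>\<close>-separated modulo the integers, and by the pigeonhole principle there are too many of
  them for the grid of mesh \<open>1 / g\<close> in the unit cube.
\<close>

lemma inhomogeneous_solution:
  fixes A :: "real ^ 'n ^ 'm" and R \<rho> :: real and b :: "real ^ 'm"
  assumes pos: "0 < R" "0 < \<rho>"
    and sep: "\<And>q. q \<in> integer_vectors \<Longrightarrow> 0 < norm q \<Longrightarrow> norm q < R \<Longrightarrow> \<rho> \<le> dist_to_integers (A *v q)"
    and h: "real CARD('n) * real h \<le> R" and g: "real CARD('m) \<le> real g * \<rho>"
    and many: "g ^ CARD('m) < J * h ^ CARD('n)"
  obtains q p where "q \<in> integer_vectors" "p \<in> integer_vectors"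
    "norm q \<le> (2 * real J + 1) * R" "norm (b - (A *v q + p)) \<le> (2 * real J + 1) * \<rho>"
proof -
  let ?N = "gauge_mod A R \<rho>"
  have g0: "0 < real g" using g pos by (metis less_le_trans of_nat_0_less_iff zero_less_card_finite zero_less_mult_pos2)
  have "?N b < 2 * real J + 1"
  proof (rule ccontr)
    assume large: "\<not> ?thesis"
    have N0: "?N 0 = 0"
      using gauge_mod_nonneg[OF pos, of A 0] gauge_mod_le_norm[OF pos, of A 0] by simp
    have "\<exists>x. ?N x = 2 * real j" if "j < J" for j
    proof -
      have "\<exists>t\<ge>0. t \<le> 1 \<and> ?N (t *\<^sub>R b) = 2 * real j"
      proof (rule IVT'[of "\<lambda>t. ?N (t *\<^sub>R b)" 0 "2 * real j" 1])
        show "continuous_on {0..1} (\<lambda>t. ?N (t *\<^sub>R b))"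
          by (intro continuous_on_compose2[OF continuous_on_gauge_mod[OF pos, of UNIV]] continuous_intros) auto
      qed (use N0 large that in auto)
      then show ?thesis by blast
    qed
    then obtain x where x: "\<And>j. j < J \<Longrightarrow> ?N (x j) = 2 * real j" by metis
    define vec :: "('n \<Rightarrow> nat) \<Rightarrow> real ^ 'n" where "vec f = (\<chi> i. real (f i))" for f
    define pt where "pt = (\<lambda>(j, f). x j + A *v vec f)"
    define cell where "cell a = (\<lambda>i. nat \<lfloor>real g * frac (pt a $ i)\<rfloor>)" for a
    define Dom where "Dom = {..<J} \<times> (UNIV \<rightarrow>\<^sub>E {..<h} :: ('n \<Rightarrow> nat) set)"
    have vec_int: "vec f \<in> integer_vectors" for f
      by (simp add: vec_def integer_vectors_def)
    have cell_range: "cell ` Dom \<subseteq> (UNIV \<rightarrow>\<^sub>E {..<g})"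
    proof -
      have "nat \<lfloor>real g * frac (pt a $ i)\<rfloor> < g" for a i
      proof -
        have "real g * frac (pt a $ i) < real g" using g0 frac_lt_1 by simp
        then show ?thesis using g0 by (simp add: nat_less_iff floor_less_iff)
      qed
      then show ?thesis by (auto simp: cell_def)
    qed
    have "card (cell ` Dom) \<le> card ((UNIV :: 'm set) \<rightarrow>\<^sub>E {..<g})"
      by (intro card_mono cell_range finite_PiE) auto
    also have "\<dots> < card Dom"
      using many by (simp add: Dom_def card_funcsetE card_cartesian_product)
    finally have "\<not> inj_on cell Dom" by (rule pigeonhole)
    then obtain j f j' f' where Dom: "(j, f) \<in> Dom" "(j', f') \<in> Dom" "(j, f) \<noteq> (j', f')"
      and eq: "cell (j, f) = cell (j', f')"
      unfolding inj_on_def by auto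
    define p where "p = (\<chi> i. of_int (\<lfloor>pt (j, f) $ i\<rfloor> - \<lfloor>pt (j', f') $ i\<rfloor>) :: real ^ 'm)"
    have p: "p \<in> integer_vectors" by (simp add: p_def integer_vectors_def)
    have close: "norm (pt (j, f) - pt (j', f') - p) < \<rho>"
    proof -
      have "norm (pt (j, f) - pt (j', f') - p) < real CARD('m) * (1 / real g)"
      proof (rule norm_less_card_times)
        fix i
        define u v where "u = frac (pt (j, f) $ i)" and "v = frac (pt (j', f') $ i)"
        have "nat \<lfloor>real g * u\<rfloor> = nat \<lfloor>real g * v\<rfloor>"
          using fun_cong[OF eq, of i] by (simp add: cell_def u_def v_def)
        moreover have "0 \<le> real g * u" "0 \<le> real g * v" by (auto simp: u_def v_def)
        ultimately have "\<lfloor>real g * u\<rfloor> = \<lfloor>real g * v\<rfloor>"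
          by (simp add: nat_eq_iff)
        then have "\<bar>real g * u - real g * v\<bar> < 1" by linarith
        then have "real g * \<bar>u - v\<bar> < 1"
          using g0 by (simp add: abs_mult flip: right_diff_distrib)
        moreover have "(pt (j, f) - pt (j', f') - p) $ i = u - v"
          by (simp add: p_def u_def v_def frac_def)
        ultimately show "\<bar>(pt (j, f) - pt (j', f') - p) $ i\<bar> < 1 / real g"
          using g0 by (simp add: pos_less_divide_eq mult.commute)
      qed
      also have "\<dots> \<le> \<rho>" using g g0 by (simp add: pos_divide_le_eq mult.commute)
      finally show ?thesis .
    qed
    have vec_close: "norm (vec f - vec f') < R"
    proof -
      have "norm (vec f - vec f') < real CARD('n) * real h"
      proof (rule norm_less_card_times)
        fix i
        have "f i < h" "f' i < h" using Dom(1,2) by (auto simp: Dom_def)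
        then show "\<bar>(vec f - vec f') $ i\<bar> < real h" by (auto simp: vec_def)
      qed
      then show ?thesis using h by simp
    qed
    show False
    proof (cases "j = j'")
      case True
      then obtain i where "f i \<noteq> f' i" using Dom(3) by auto
      then have "vec f \<noteq> vec f'" by (auto simp: vec_def vec_eq_iff)
      then have "\<rho> \<le> dist_to_integers (A *v (vec f - vec f'))"
        using vec_close by (intro sep integer_vectors_diff vec_int) auto
      also have "\<dots> \<le> norm (A *v (vec f - vec f') - p)"
        by (rule dist_to_integers_le[OF p])
      also have "A *v (vec f - vec f') - p = pt (j, f) - pt (j', f') - p"
        using True by (simp add: pt_def matrix_vector_mult_diff_distrib)
      finally show False using close by simp
    next
      case False
      have "x j - x j' - (A *v (vec f' - vec f) + p) = pt (j, f) - pt (j', f') - p"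
        by (simp add: pt_def matrix_vector_mult_diff_distrib)
      then have 1: "?N (x j - x j') \<le> 1"
        using p vec_int vec_close close
        by (intro gauge_mod_le_1[OF pos, of "vec f' - vec f" p] integer_vectors_diff)
          (simp_all only: norm_minus_commute[of "vec f'"])
      have "x j' - x j - (A *v (vec f - vec f') + - p) = - (pt (j, f) - pt (j', f') - p)"
        by (simp add: pt_def matrix_vector_mult_diff_distrib)
      then have 2: "?N (x j' - x j) \<le> 1"
        using p vec_int vec_close close
        by (intro gauge_mod_le_1[OF pos, of "vec f - vec f'" "- p"] integer_vectors_diff integer_vectors_minus)
          (simp_all only: norm_minus_cancel)
      have "j < J" "j' < J" using Dom by (auto simp: Dom_def)
      then have "\<bar>2 * real j - 2 * real j'\<bar> \<le> 1"
        using 1 2 x[of j] x[of j'] gauge_mod_add[OF pos, of A "x j'" "x j - x j'"]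
          gauge_mod_add[OF pos, of A "x j" "x j' - x j"] by simp
      then show False using False by linarith
    qed
  qed
  then obtain q p where "q \<in> integer_vectors" "p \<in> integer_vectors"
    "norm q / R < 2 * real J + 1" "norm (b - (A *v q + p)) / \<rho> < 2 * real J + 1"
    by (rule gauge_mod_lessE[OF pos])
  then show thesis using pos that by (simp add: pos_divide_less_eq less_imp_le)
qed


section \<open>Good scales\<close>

text \<open>The scales \<open>l\<close> at which the singularity condition fails for \<open>A\<close> with the constant \<open>\<epsilon>\<close>.\<close>

definition good_scales :: "real ^ 'n ^ 'm \<Rightarrow> real \<Rightarrow> nat set" where
  "good_scales A \<epsilon> = {l. \<forall>q\<in>integer_vectors. 0 < norm q \<and> norm q < 2 ^ l \<longrightarrow>
     \<epsilon> * 2 powr (- (real CARD('n) * real l / real CARD('m))) \<le> dist_to_integers (A *v q)}"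

lemma good_scales_dense:
  fixes A :: "real ^ 'n ^ 'm"
  assumes "\<not> singular_on_average A"
  obtains \<epsilon> \<delta> where "0 < \<epsilon>" "0 < \<delta>"
    "\<exists>\<^sub>\<infinity>N. \<delta> * real N \<le> real (card (good_scales A \<epsilon> \<inter> {1..N}))"
proof -
  obtain \<epsilon> where \<epsilon>: "0 < \<epsilon>" and not_lim: "\<not> (\<lambda>N. real (card {l \<in> {1..N}. \<exists>q\<in>integer_vectors.
      dist_to_integers (A *v q) < \<epsilon> * 2 powr (- (real CARD('n) * real l / real CARD('m)))
      \<and> 0 < norm q \<and> norm q < 2 ^ l}) / real N) \<longlonglongrightarrow> 1"
    using assms unfolding singular_on_average_def by blast
  define S where "S N = {l \<in> {1..N}. \<exists>q\<in>integer_vectors.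
      dist_to_integers (A *v q) < \<epsilon> * 2 powr (- (real CARD('n) * real l / real CARD('m)))
      \<and> 0 < norm q \<and> norm q < 2 ^ l}" for N
  have S: "card (S N) + card (good_scales A \<epsilon> \<inter> {1..N}) = N" for N
  proof -
    have "S N \<union> good_scales A \<epsilon> \<inter> {1..N} = {1..N}"
      by (auto simp: S_def good_scales_def not_le)
    moreover have "S N \<inter> (good_scales A \<epsilon> \<inter> {1..N}) = {}"
      by (force simp: S_def good_scales_def)
    moreover have "finite (S N)" by (simp add: S_def)
    ultimately show ?thesis
      by (metis card_Un_disjoint card_atLeastAtMost diff_Suc_1 finite_Int finite_atLeastAtMost)
  qed
  obtain \<delta> where \<delta>: "0 < \<delta>" and freq: "\<not> (\<forall>\<^sub>F N in sequentially. dist (real (card (S N)) / real N) 1 < \<delta>)"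
    using not_lim unfolding tendsto_iff S_def[symmetric] by blast
  have "\<exists>\<^sub>\<infinity>N. \<not> dist (real (card (S N)) / real N) 1 < \<delta>"
    using freq by (simp add: frequently_def cofinite_eq_sequentially)
  then have "\<exists>\<^sub>\<infinity>N. \<delta> * real N \<le> real (card (good_scales A \<epsilon> \<inter> {1..N}))"
  proof (rule INFM_mono)
    fix N assume far: "\<not> dist (real (card (S N)) / real N) 1 < \<delta>"
    show "\<delta> * real N \<le> real (card (good_scales A \<epsilon> \<inter> {1..N}))"
    proof (cases "N = 0")
      case False
      have "real (card (S N)) + real (card (good_scales A \<epsilon> \<inter> {1..N})) = real N"
        using S[of N] by (metis of_nat_add)
      then have "real (card (S N)) / real N = 1 - real (card (good_scales A \<epsilon> \<inter> {1..N})) / real N"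
        using False by (simp add: field_simps)
      then have "\<delta> \<le> real (card (good_scales A \<epsilon> \<inter> {1..N})) / real N"
        using far by (simp add: dist_real_def)
      then show ?thesis using False by (simp add: pos_le_divide_eq)
    qed simp
  qed
  then show thesis using that \<epsilon> \<delta> by blast
qed

text \<open>
  All inhomogeneous problems are solvable at a good scale, with a constant \<open>L\<close> that depends neither on the
  scale nor on the target.
\<close>

lemma good_scale_inhomogeneous:
  fixes A :: "real ^ 'n ^ 'm" and \<epsilon> :: real
  assumes \<epsilon>: "0 < \<epsilon>"
  defines "\<beta> \<equiv> 2 powr (- (real CARD('n) / real CARD('m)))"
  shows "\<exists>L::nat. 0 < L \<and> (\<forall>l\<in>good_scales A \<epsilon>. CARD('n) \<le> l \<longrightarrow>
    (\<forall>b. \<exists>q\<in>integer_vectors. \<exists>p\<in>integer_vectors.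
      norm q \<le> real L * 2 ^ l \<and> norm (b - (A *v q + p)) \<le> real L * (\<epsilon> * \<beta> ^ l)))"
proof -
  define m n where "m = CARD('m)" and "n = CARD('n)"
  have mn: "0 < m" "0 < n" by (simp_all add: m_def n_def)
  have \<beta>: "0 < \<beta>" "\<beta> \<le> 1" 
    using powr_mono[of "- (real CARD('n) / real CARD('m))" 0 2] by (auto simp: \<beta>_def)
  define J where "J = nat \<lfloor>(real m / \<epsilon> + 1) ^ m * (2 * real n) ^ n\<rfloor> + 1"
  have J: "(real m / \<epsilon> + 1) ^ m * (2 * real n) ^ n < real J"
    unfolding J_def by linarith
  have "\<exists>q\<in>integer_vectors. \<exists>p\<in>integer_vectors.
      norm q \<le> real (2 * J + 1) * 2 ^ l \<and> norm (b - (A *v q + p)) \<le> real (2 * J + 1) * (\<epsilon> * \<beta> ^ l)"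
    if l: "l \<in> good_scales A \<epsilon>" "n \<le> l" for l b
  proof -
    have \<beta>_l: "2 powr (- (real CARD('n) * real l / real CARD('m))) = \<beta> ^ l"
      by (simp add: \<beta>_def powr_powr flip: powr_realpow)
    define h where "h = nat \<lfloor>2 ^ l / real n\<rfloor>"
    define g where "g = nat \<lceil>real m / (\<epsilon> * \<beta> ^ l)\<rceil>"
    have pos: "0 < \<epsilon> * \<beta> ^ l" using \<epsilon> \<beta> by simp
    have "real n < 2 ^ l"
      using l(2) of_nat_less_two_power[of l, where 'a=real] by linarith
    then have quot: "1 \<le> 2 ^ l / real n" using mn by simp
    have h: "real h \<le> 2 ^ l / real n" "2 ^ l / real n \<le> 2 * real h"
    proof -
      have "1 \<le> \<lfloor>2 ^ l / real n\<rfloor>" using quot by (simp add: le_floor_iff)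
      then have "real h = of_int \<lfloor>2 ^ l / real n\<rfloor>" "1 \<le> real h"
        by (simp_all add: h_def)
      then show "real h \<le> 2 ^ l / real n" "2 ^ l / real n \<le> 2 * real h" by linarith+
    qed
    have g: "real m / (\<epsilon> * \<beta> ^ l) \<le> real g" "real g \<le> real m / (\<epsilon> * \<beta> ^ l) + 1"
      using pos unfolding g_def by (auto simp: of_nat_ceiling intro: less_imp_le)
    \<comment> \<open>Both \<open>g ^ m\<close> and \<open>h ^ n\<close> are of order \<open>2 ^ (n l)\<close>, so \<open>J\<close> need not depend on \<open>l\<close>.\<close>
    have \<beta>_pow: "(\<beta> ^ l) ^ m * (2 ^ l) ^ n = 1"
    proof -
      have "\<beta> ^ m = 2 powr (- real n)"
        by (simp add: \<beta>_def m_def n_def powr_powr flip: powr_realpow)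
      then have "\<beta> ^ m * 2 ^ n = 1"
        by (simp add: powr_minus powr_realpow)
      then have "(\<beta> ^ m * 2 ^ n) ^ l = 1" by simp
      then show ?thesis by (simp add: power_mult_distrib mult.commute flip: power_mult)
    qed
    have "real g ^ m < real J * real h ^ n"
    proof -
      have "real g * \<beta> ^ l \<le> (real m / (\<epsilon> * \<beta> ^ l) + 1) * \<beta> ^ l"
        using g(2) \<beta> by (intro mult_right_mono) auto
      also have "\<dots> = real m / \<epsilon> + \<beta> ^ l"
        using \<beta> \<epsilon> by (simp add: field_simps)
      also have "\<dots> \<le> real m / \<epsilon> + 1" using \<beta> by (simp add: power_le_one)
      finally have "(real g * \<beta> ^ l) ^ m \<le> (real m / \<epsilon> + 1) ^ m"
        using \<beta> by (intro power_mono) auto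
      then have "(real g * \<beta> ^ l) ^ m * (2 * real n) ^ n \<le> (real m / \<epsilon> + 1) ^ m * (2 * real n) ^ n"
        by (intro mult_right_mono) auto
      then have "(real g * \<beta> ^ l) ^ m * (2 * real n) ^ n < real J" using J by linarith
      then have "(real g * \<beta> ^ l) ^ m * (2 * real n) ^ n * real h ^ n < real J * real h ^ n"
        using quot h by (intro mult_strict_right_mono) auto
      moreover have "(real g * \<beta> ^ l) ^ m * (2 ^ l) ^ n \<le> (real g * \<beta> ^ l) ^ m * (2 * real n * real h) ^ n"
        using h(2) mn \<beta> by (intro mult_left_mono power_mono) (auto simp: pos_divide_le_eq mult_ac)
      moreover have "(real g * \<beta> ^ l) ^ m * (2 ^ l) ^ n = real g ^ m"
        using \<beta>_pow by (simp add: power_mult_distrib mult.assoc)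
      moreover have "(real g * \<beta> ^ l) ^ m * (2 * real n) ^ n * real h ^ n =
        (real g * \<beta> ^ l) ^ m * (2 * real n * real h) ^ n"
        by (simp add: power_mult_distrib)
      ultimately show ?thesis by linarith
    qed
    then have many: "g ^ CARD('m) < J * h ^ CARD('n)"
      unfolding m_def n_def by (simp flip: of_nat_power of_nat_mult)
    have sep: "\<epsilon> * \<beta> ^ l \<le> dist_to_integers (A *v q)"
      if "q \<in> integer_vectors" "0 < norm q" "norm q < 2 ^ l" for q
      using l(1) that by (simp add: good_scales_def \<beta>_l)
    have box: "real CARD('n) * real h \<le> 2 ^ l"
      using mult_left_mono[OF h(1), of "real n"] mn by (simp add: n_def)
    have grid: "real CARD('m) \<le> real g * (\<epsilon> * \<beta> ^ l)"
      using g(1) unfolding pos_divide_le_eq[OF pos] m_def .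
    have "(0::real) < 2 ^ l" by simp
    then obtain q p where "q \<in> integer_vectors" "p \<in> integer_vectors"
      "norm q \<le> (2 * real J + 1) * 2 ^ l" "norm (b - (A *v q + p)) \<le> (2 * real J + 1) * (\<epsilon> * \<beta> ^ l)"
      by (rule inhomogeneous_solution[OF _ pos sep box grid many, of b])
    moreover have "real (2 * J + 1) = 2 * real J + 1" by simp
    ultimately show ?thesis by metis
  qed
  then show ?thesis by (intro exI[of _ "2 * J + 1"]) (auto simp: n_def)
qed


section \<open>Porosity of the set of bad targets\<close>

text \<open>
  The points of \<^term>\<open>Bad A \<epsilon>\<close> of norm at most \<open>k\<close> for which the defining inequality, with \<open>\<epsilon> / 2\<close> in place
  of \<open>\<epsilon>\<close>, holds for all \<open>q\<close> of norm at least \<open>k\<close>. Halving \<open>\<epsilon>\<close> turns the lower limit into a uniform inequality.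
\<close>

definition Bad_from :: "real ^ 'n ^ 'm \<Rightarrow> real \<Rightarrow> nat \<Rightarrow> (real ^ 'm) set" where
  "Bad_from A \<epsilon> k = {b \<in> Bad A \<epsilon>. norm b \<le> real k \<and> (\<forall>q\<in>integer_vectors. real k \<le> norm q \<longrightarrow>
     \<epsilon> / 2 < norm q powr (real CARD('n) / real CARD('m)) * dist_to_integers (A *v q - b))}"

lemma Bad_eq_UN_Bad_from:
  fixes A :: "real ^ 'n ^ 'm"
  assumes "0 < \<epsilon>"
  shows "Bad A \<epsilon> = (\<Union>k. Bad_from A \<epsilon> k)"
proof (intro subset_antisym subsetI)
  fix b assume b: "b \<in> Bad A \<epsilon>"
  let ?f = "\<lambda>q. norm q powr (real CARD('n) / real CARD('m)) * dist_to_integers (A *v q - b)"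
  have "ereal (\<epsilon> / 2) < ereal \<epsilon>" using assms by simp
  also have "\<dots> \<le> Liminf (inf at_infinity (principal integer_vectors)) (\<lambda>q. ereal (?f q))"
    using b by (simp add: Bad_def eps_bad_def)
  finally have "\<forall>\<^sub>F q in inf at_infinity (principal integer_vectors). \<epsilon> / 2 < ?f q"
    by (auto dest: less_LiminfD)
  then obtain B where B: "\<And>q. B \<le> norm q \<Longrightarrow> q \<in> integer_vectors \<Longrightarrow> \<epsilon> / 2 < ?f q"
    unfolding eventually_inf_principal eventually_at_infinity by blast
  obtain k :: nat where "max B (norm b) \<le> real k" using real_arch_simple by blast
  then have "b \<in> Bad_from A \<epsilon> k" using b B by (auto simp: Bad_from_def)
  then show "b \<in> (\<Union>k. Bad_from A \<epsilon> k)" by blast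
qed (auto simp: Bad_from_def)

text \<open>
  Solving the inhomogeneous problem for \<open>b - A q\<^sub>0\<close> with an integral \<open>q\<^sub>0\<close> of norm \<open>2 L 2\<^sup>l\<close> gives an approximation of
  \<open>b\<close> with \<open>q\<close> of norm comparable to \<open>2\<^sup>l\<close>, also from below. For large \<open>l\<close> this keeps \<open>q\<close> beyond the threshold \<open>k\<close>, so
  that the points of the set stay away from \<open>A q + p\<close>.
\<close>

lemma Bad_from_porous:
  fixes A :: "real ^ 'n ^ 'm" and \<epsilon> \<epsilon>' :: real
  assumes "0 < \<epsilon>" "0 < \<epsilon>'"
  defines "\<beta> \<equiv> 2 powr (- (real CARD('n) / real CARD('m)))"
  obtains K \<kappa> where "0 < K" "0 < \<kappa>" "\<And>k. \<exists>l1. \<forall>l\<in>good_scales A \<epsilon>'. l1 \<le> l \<longrightarrow>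
    (\<forall>b\<in>Bad_from A \<epsilon> k. \<exists>y. dist b y \<le> K * \<beta> ^ l \<and> ball y (\<kappa> * \<beta> ^ l) \<inter> Bad_from A \<epsilon> k = {})"
proof -
  let ?e = "real CARD('n) / real CARD('m)"
  obtain L :: nat where L: "0 < L" and sol: "\<And>l b. l \<in> good_scales A \<epsilon>' \<Longrightarrow> CARD('n) \<le> l \<Longrightarrow>
    \<exists>q\<in>integer_vectors. \<exists>p\<in>integer_vectors.
      norm q \<le> real L * 2 ^ l \<and> norm (b - (A *v q + p)) \<le> real L * (\<epsilon>' * \<beta> ^ l)"
    using good_scale_inhomogeneous[OF assms(2), of A] unfolding \<beta>_def by metis
  define \<kappa> where "\<kappa> = \<epsilon> / 2 / (3 * real L) powr ?e"
  have \<kappa>: "0 < \<kappa>" using assms L by (simp add: \<kappa>_def)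
  have "\<exists>y. dist b y \<le> real L * \<epsilon>' * \<beta> ^ l \<and> ball y (\<kappa> * \<beta> ^ l) \<inter> Bad_from A \<epsilon> k = {}"
    if l: "l \<in> good_scales A \<epsilon>'" "max CARD('n) k \<le> l" for l k b
  proof -
    \<comment> \<open>The choice of the coordinate direction is arbitrary.\<close>
    define q0 :: "real ^ 'n" where "q0 = axis undefined (2 * real L * 2 ^ l)"
    have q0: "q0 \<in> integer_vectors"
      by (auto simp: q0_def integer_vectors_def axis_def)
    have norm_q0: "norm q0 = 2 * real L * 2 ^ l"
      unfolding q0_def norm_eq_sqrt_inner inner_axis_axis by (simp only: simp_thms if_True inner_real_def real_sqrt_abs2) simp
    obtain q1 p where q1: "q1 \<in> integer_vectors" "p \<in> integer_vectors" "norm q1 \<le> real L * 2 ^ l"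
      "norm (b - A *v q0 - (A *v q1 + p)) \<le> real L * (\<epsilon>' * \<beta> ^ l)"
      using sol[OF l(1), of "b - A *v q0"] l(2) by auto
    define q where "q = q0 + q1"
    have q: "q \<in> integer_vectors" using q0 q1 by (simp add: q_def integer_vectors_add)
    have lower: "real L * 2 ^ l \<le> norm q"
      using norm_diff_ineq[of q0 q1] norm_q0 q1(3) by (simp add: q_def)
    have upper: "norm q \<le> 3 * real L * 2 ^ l"
      using norm_triangle_ineq[of q0 q1] norm_q0 q1(3) by (simp add: q_def)
    have "real k \<le> real L * 2 ^ l"
    proof -
      have "real k \<le> 2 ^ l" using l(2) of_nat_less_two_power[of l, where 'a=real] by linarith
      also have "\<dots> \<le> real L * 2 ^ l" using L by simp
      finally show ?thesis .
    qed
    then have k: "real k \<le> norm q" using lower by linarith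
    define y where "y = A *v q + p"
    have "dist b y \<le> real L * \<epsilon>' * \<beta> ^ l"
      using q1(4) by (simp add: y_def q_def dist_norm matrix_vector_right_distrib algebra_simps)
    moreover have "c \<notin> ball y (\<kappa> * \<beta> ^ l)" if c: "c \<in> Bad_from A \<epsilon> k" for c
    proof -
      have "\<epsilon> / 2 < norm q powr ?e * dist_to_integers (A *v q - c)"
        using c q k by (simp add: Bad_from_def)
      also have "\<dots> \<le> norm q powr ?e * norm (y - c)"
        using dist_to_integers_le[OF integer_vectors_minus[OF q1(2)], of "A *v q - c"]
        by (intro mult_left_mono) (simp_all add: y_def algebra_simps)
      also have "\<dots> \<le> (3 * real L * 2 ^ l) powr ?e * norm (y - c)"
        using upper by (intro mult_right_mono powr_mono2) auto
      also have "(3 * real L * 2 ^ l) powr ?e = (3 * real L) powr ?e / \<beta> ^ l"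
        by (simp add: powr_mult \<beta>_def powr_powr powr_minus divide_inverse mult_ac power_inverse
            flip: powr_realpow)
      finally have "\<epsilon> / 2 < (3 * real L) powr ?e / \<beta> ^ l * norm (y - c)" .
      moreover have "0 < \<beta> ^ l" "0 < (3 * real L) powr ?e" using L by (simp_all add: \<beta>_def)
      ultimately have "\<kappa> * \<beta> ^ l < norm (y - c)"
        by (simp add: \<kappa>_def field_simps)
      then show ?thesis by (simp add: dist_norm)
    qed
    ultimately show ?thesis by blast
  qed
  then have "\<exists>l1. \<forall>l\<in>good_scales A \<epsilon>'. l1 \<le> l \<longrightarrow>
    (\<forall>b\<in>Bad_from A \<epsilon> k. \<exists>y. dist b y \<le> real L * \<epsilon>' * \<beta> ^ l \<and>
      ball y (\<kappa> * \<beta> ^ l) \<inter> Bad_from A \<epsilon> k = {})" for k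
    by (intro exI[of _ "max CARD('n) k"]) blast
  then show thesis using that[of "real L * \<epsilon>'" \<kappa>] L assms(2) \<kappa> by simp
qed

theorem theorem1p5:
  fixes A :: "real ^ 'n ^ 'm" and \<epsilon> :: real
  assumes "\<not> singular_on_average A"
    and "\<epsilon> > 0"
  shows "hausdorff_dim (Bad A \<epsilon>) < of_nat CARD('m)"
proof -
  define \<beta> :: real where "\<beta> = 2 powr (- (real CARD('n) / real CARD('m)))"
  have \<beta>: "0 < \<beta>" "\<beta> < 1"
    using powr_less_mono[of "- (real CARD('n) / real CARD('m))" 0 2] by (auto simp: \<beta>_def)
  obtain \<epsilon>' \<delta> where \<delta>: "0 < \<epsilon>'" "0 < \<delta>"
    "\<exists>\<^sub>\<infinity>N. \<delta> * real N \<le> real (card (good_scales A \<epsilon>' \<inter> {1..N}))"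
    using good_scales_dense[OF assms(1)] .
  obtain K \<kappa> where K: "0 < K" "0 < \<kappa>" "\<And>k. \<exists>l1. \<forall>l\<in>good_scales A \<epsilon>'. l1 \<le> l \<longrightarrow>
    (\<forall>b\<in>Bad_from A \<epsilon> k. \<exists>y. dist b y \<le> K * \<beta> ^ l \<and> ball y (\<kappa> * \<beta> ^ l) \<inter> Bad_from A \<epsilon> k = {})"
    using Bad_from_porous[OF assms(2) \<delta>(1), of A] unfolding \<beta>_def by blast
  have "bounded (Bad_from A \<epsilon> k)" for k
    by (auto simp: bounded_iff Bad_from_def)
  then have "hausdorff_dim (\<Union>k. Bad_from A \<epsilon> k) < of_nat DIM(real ^ 'm)"
    using \<beta> K \<delta> by (intro hausdorff_dim_mean_porous)
  then show ?thesis by (simp add: Bad_eq_UN_Bad_from[OF assms(2)])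
qed

end
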